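(* Let $A\in\mathbb{R}^{n\times n}$ be nonsingular with $A^{-1}=B_1B_2\cdots B_k$, where the $B_i\in\mathbb{R}^{n\times n}$ are (nonsingular) bidiagonal matrices (each upper or lower bidiagonal), let $b\in\mathbb{R}^n$, and let $x=A^{-1}b$. Suppose $x$ is computed in floating-point arithmetic with unit roundoff $u$ by forming $B_1(B_2(\cdots(B_kb)))$ by successive matrix--vector products, and let $\widehat{x}$ be the computed vector. Put $\gamma_2=2u/(1-2u)$ and $\tau=(2n-1)\gamma_2/(1-(2n-1)\gamma_2)$, where $2u<1$ and $(2n-1)\gamma_2<1$. Then $$|\widehat{x}-x|\le\bigl((1+\gamma_2)^k-1\bigr)|B_1|\,|B_2|\cdots|B_k|\,|b|,$$ $$|b-A\widehat{x}|\le\bigl((1+\tau)^k-1\bigr)|B_k^{-1}|\,|B_{k-1}^{-1}|\cdots|B_1^{-1}|\,|\widehat{x}|.$$ If, moreover, all the $B_i$ are nonnegative or all the $B_i$ have a checkerboard sign pattern, then $$|\widehat{x}-x|\le\bigl((1+\gamma_2)^k-1\bigr)|A^{-1}|\,|b|,$$ $$|b-A\widehat{x}|\le\bigl((1+\tau)^k-1\bigr)|A|\,|\widehat{x}|=\bigl(2k(2n-1)u+O(u^2)\bigr)|A|\,|\widehat{x}|.$$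
   Context: For a matrix or vector, $|\cdot|$ is taken entrywise, and inequalities between matrices or vectors hold componentwise. The standard model of floating-point arithmetic is used: every operation $\mathrm{op}\in\{+,-,\times,/\}$ on floating-point numbers satisfies $\mathrm{fl}(x\,\mathrm{op}\,y)=(x\,\mathrm{op}\,y)(1+\delta)$ with $|\delta|\le u$. The $O(u^2)$ term is as $u\to0$ with $n,k$ fixed. A matrix $C\in\mathbb{R}^{n\times n}$ has a checkerboard sign pattern if $C=\Sigma|C|\Sigma$ or $C=-\Sigma|C|\Sigma$, where $\Sigma=\operatorname{diag}(1,-1,1,\dots,(-1)^{n-1})$. A matrix is nonnegative if all its entries are nonnegative. A matrix is upper bidiagonal if its only possibly nonzero entries are in positions $(i,i)$ and $(i,i+1)$; it is lower bidiagonal if its transpose is upper bidiagonal. *)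

theory Defs
  imports
    Complex_Main
    "HOL-Library.Landau_Symbols"
    "Jordan_Normal_Form.Gauss_Jordan_Elimination"
begin

subsection \<open>Matrices\<close>

abbreviation mat_abs :: "real mat \<Rightarrow> real mat" where
  "mat_abs \<equiv> map_mat abs"

abbreviation vec_abs :: "real vec \<Rightarrow> real vec" where
  "vec_abs \<equiv> map_vec abs"

text \<open>Meaningful for invertible matrices only; see \<open>mat_inv_works\<close>.\<close>

definition mat_inv :: "real mat \<Rightarrow> real mat" where
  "mat_inv A = the (mat_inverse A)"

lemma mat_inv_works:
  assumes A: "A \<in> carrier_mat n n" and inv: "invertible_mat A"
  shows "A * mat_inv A = 1\<^sub>m n" "mat_inv A * A = 1\<^sub>m n" "mat_inv A \<in> carrier_mat n n"
proof -
  from inv obtain B where B: "A * B = 1\<^sub>m n" "B * A = 1\<^sub>m (dim_row B)"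
    using A unfolding invertible_mat_def inverts_mat_def by auto
  have "dim_col B = n"
    using arg_cong[OF B(1), of dim_col] by simp
  moreover have "dim_row B = n"
    using arg_cong[OF B(2), of dim_col] A by simp
  ultimately have "A \<in> Units (ring_mat TYPE(real) n ())"
    using A B unfolding Units_def ring_mat_def by auto
  then obtain C where "mat_inverse A = Some C"
    using mat_inverse(1)[OF A, where b = "()"] by (cases "mat_inverse A") auto
  then show "A * mat_inv A = 1\<^sub>m n" "mat_inv A * A = 1\<^sub>m n" "mat_inv A \<in> carrier_mat n n"
    using mat_inverse(2)[OF A] unfolding mat_inv_def by auto
qed

text \<open>\<open>mat_prod n [B\<^sub>1, \<dots>, B\<^sub>k]\<close> is the product \<open>B\<^sub>1 \<cdots> B\<^sub>k\<close> of matrices of order \<open>n\<close>.\<close>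

definition mat_prod :: "nat \<Rightarrow> real mat list \<Rightarrow> real mat" where
  "mat_prod n Bs = foldr (*) Bs (1\<^sub>m n)"

definition upper_bidiagonal :: "real mat \<Rightarrow> bool" where
  "upper_bidiagonal B \<longleftrightarrow>
     (\<forall>i<dim_row B. \<forall>j<dim_col B. j \<noteq> i \<and> j \<noteq> i + 1 \<longrightarrow> B $$ (i, j) = 0)"

definition lower_bidiagonal :: "real mat \<Rightarrow> bool" where
  "lower_bidiagonal B \<longleftrightarrow> upper_bidiagonal (transpose_mat B)"

definition nonneg_mat :: "real mat \<Rightarrow> bool" where
  "nonneg_mat C \<longleftrightarrow> 0\<^sub>m (dim_row C) (dim_col C) \<le> C"

definition checkerboard :: "real mat \<Rightarrow> bool" where
  "checkerboard C \<longleftrightarrow>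
     (let \<Sigma> = mat_diag (dim_row C) (\<lambda>i. (-1) ^ i)
      in C = \<Sigma> * mat_abs C * \<Sigma> \<or> C = - (\<Sigma> * mat_abs C * \<Sigma>))"

subsection \<open>Floating-point arithmetic\<close>

datatype fp_op = Add | Sub | Mul | Div

fun exact :: "fp_op \<Rightarrow> real \<Rightarrow> real \<Rightarrow> real" where
  "exact Add x y = x + y"
| "exact Sub x y = x - y"
| "exact Mul x y = x * y"
| "exact Div x y = x / y"

text \<open>
  \<open>F\<close> is the set of floating-point numbers and \<open>fl op x y\<close> the computed value of
  \<open>x op y\<close>. As usual in the standard model, overflow and underflow are ignored, so \<open>F\<close> is
  closed under the computed operations.
\<close>

definition standard_model :: "real \<Rightarrow> real set \<Rightarrow> (fp_op \<Rightarrow> real \<Rightarrow> real \<Rightarrow> real) \<Rightarrow> bool" where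
  "standard_model u F fl \<longleftrightarrow>
     (\<forall>op. \<forall>x\<in>F. \<forall>y\<in>F. (op = Div \<longrightarrow> y \<noteq> 0) \<longrightarrow>
        fl op x y \<in> F \<and> (\<exists>\<delta>. \<bar>\<delta>\<bar> \<le> u \<and> fl op x y = exact op x y * (1 + \<delta>)))"

text \<open>
  Matrix-vector products that exploit the bidiagonal structure: operations with the entries
  outside the two diagonals are not performed.
\<close>

definition fl_upper_mult_vec ::
  "(fp_op \<Rightarrow> real \<Rightarrow> real \<Rightarrow> real) \<Rightarrow> real mat \<Rightarrow> real vec \<Rightarrow> real vec" where
  "fl_upper_mult_vec fl B v = vec (dim_row B) (\<lambda>i.
     if i + 1 < dim_row B
     then fl Add (fl Mul (B $$ (i, i)) (v $ i)) (fl Mul (B $$ (i, i + 1)) (v $ (i + 1)))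
     else fl Mul (B $$ (i, i)) (v $ i))"

definition fl_lower_mult_vec ::
  "(fp_op \<Rightarrow> real \<Rightarrow> real \<Rightarrow> real) \<Rightarrow> real mat \<Rightarrow> real vec \<Rightarrow> real vec" where
  "fl_lower_mult_vec fl B v = vec (dim_row B) (\<lambda>i.
     if 0 < i
     then fl Add (fl Mul (B $$ (i, i - 1)) (v $ (i - 1))) (fl Mul (B $$ (i, i)) (v $ i))
     else fl Mul (B $$ (i, i)) (v $ i))"

text \<open>A relation, because a diagonal matrix may be treated as upper or as lower bidiagonal.\<close>

definition computed_mult_vec ::
  "(fp_op \<Rightarrow> real \<Rightarrow> real \<Rightarrow> real) \<Rightarrow> real mat \<Rightarrow> real vec \<Rightarrow> real vec \<Rightarrow> bool" where
  "computed_mult_vec fl B v y \<longleftrightarrow>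
     upper_bidiagonal B \<and> y = fl_upper_mult_vec fl B v \<or>
     lower_bidiagonal B \<and> y = fl_lower_mult_vec fl B v"

text \<open>
  \<open>computed_prod fl [B\<^sub>1, \<dots>, B\<^sub>k] b y\<close>: \<open>y\<close> is the computed value of
  \<open>B\<^sub>1 (B\<^sub>2 (\<cdots> (B\<^sub>k b)))\<close>.
\<close>

fun computed_prod ::
  "(fp_op \<Rightarrow> real \<Rightarrow> real \<Rightarrow> real) \<Rightarrow> real mat list \<Rightarrow> real vec \<Rightarrow> real vec \<Rightarrow> bool" where
  "computed_prod fl [] b y \<longleftrightarrow> y = b"
| "computed_prod fl (B # Bs) b y \<longleftrightarrow>
     (\<exists>v. computed_prod fl Bs b v \<and> computed_mult_vec fl B v y)"

definition gamma2 :: "real \<Rightarrow> real" where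
  "gamma2 u = 2 * u / (1 - 2 * u)"

definition tau :: "nat \<Rightarrow> real \<Rightarrow> real" where
  "tau n u = (2 * real n - 1) * gamma2 u / (1 - (2 * real n - 1) * gamma2 u)"

end

theory Submission
  imports Defs "Jordan_Normal_Form.Determinant" "HOL-Real_Asymp.Real_Asymp"
begin

text \<open>
  Everything follows from a structural fact about one computed product \<open>y\<close> of a bidiagonal
  matrix \<open>B\<close> with a vector \<open>v\<close>.  By the standard model, \<open>y = B' v\<close>, where
  \<open>B'\<close> arises from \<open>B\<close> by multiplying each of the at most \<open>2n - 1\<close> entries in the
  band by a factor within \<open>gamma2 u\<close> of \<open>1\<close>.  The bipartite graph of rows and columns
  that such a band defines is a path, so any choice of factors on its edges can be written as a
  product of potentials at the vertices: \<open>B' = D\<^sub>r B D\<^sub>c\<close> with positive diagonal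
  matrices (\<open>band_scaling\<close>, \<open>computed_mult_vec_scaling\<close>).  Hence
  \<open>B'\<close> is invertible, and entry \<open>(i, j)\<close> of its inverse is that of \<open>B\<^sup>-\<^sup>1\<close>
  divided by \<open>c i * r j\<close>.  Along the path from column \<open>i\<close> to row \<open>j\<close>, this divisor is
  an alternating product and quotient of at most \<open>2n - 1\<close> of the factors, so it changes the entry
  by a relative amount of at most \<open>tau n u\<close>.

  Consequently \<open>xhat\<close> is a product of perturbed \<open>B\<^sub>i\<close> applied to \<open>b\<close>, and \<open>b\<close>
  is a product, in reverse order, of perturbed \<open>B\<^sub>i\<^sup>-\<^sup>1\<close> applied to \<open>xhat\<close>
  (\<open>computed_prod_perturbed\<close>).  Since the unperturbed products are \<open>A\<^sup>-\<^sup>1\<close> and \<open>A\<close>,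
  one perturbation bound for products of matrices (\<open>mat_prod_perturbed_mult_vec\<close>) gives both
  the forward bound and the residual bound.

  For structured factors it remains to see that the product of the absolute values is the absolute
  value of the product.  This holds for matrices that share a sign pattern
  \<open>\<plusminus> \<sigma> i * \<sigma> j\<close>: all terms of each entry of a product then have the same sign
  (\<open>mat_abs_mat_prod\<close>).  Nonnegative matrices have \<open>\<sigma> = 1\<close>, checkerboard matrices
  \<open>\<sigma> i = (-1) ^ i\<close>, and inverting a bidiagonal matrix multiplies \<open>\<sigma>\<close> by
  \<open>(-1) ^ i\<close> (\<open>bidiagonal_inverse_sign_pattern\<close>), so that it exchanges the two classes.
\<close>

section \<open>Matrix products entry by entry\<close>

lemma mult_mat_entry:
  fixes A B :: "'a::semiring_0 mat"
  assumes "A \<in> carrier_mat n n" "B \<in> carrier_mat n n" "i < n" "j < n"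
  shows "(A * B) $$ (i, j) = (\<Sum>l<n. A $$ (i, l) * B $$ (l, j))"
  using assms by (auto simp: scalar_prod_def atLeast0LessThan intro!: sum.cong)

lemma mult_mat_vec_entry:
  fixes A :: "'a::semiring_0 mat"
  assumes "A \<in> carrier_mat n n" "v \<in> carrier_vec n" "i < n"
  shows "(A *\<^sub>v v) $ i = (\<Sum>l<n. A $$ (i, l) * v $ l)"
  using assms by (auto simp: scalar_prod_def atLeast0LessThan intro!: sum.cong)

lemma mat_prod_Nil [simp]: "mat_prod n [] = 1\<^sub>m n"
  by (simp add: mat_prod_def)

lemma mat_prod_Cons [simp]: "mat_prod n (C # Cs) = C * mat_prod n Cs"
  by (simp add: mat_prod_def)

lemma mat_prod_carrier:
  "set Cs \<subseteq> carrier_mat n n \<Longrightarrow> mat_prod n Cs \<in> carrier_mat n n"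
  by (induction Cs) (auto intro: mult_carrier_mat)

lemma mat_prod_snoc:
  assumes "set Cs \<subseteq> carrier_mat n n" and D: "D \<in> carrier_mat n n"
  shows "mat_prod n (Cs @ [D]) = mat_prod n Cs * D"
  using assms(1)
proof (induction Cs)
  case Nil
  then show ?case using D by simp
next
  case (Cons C Cs)
  then have "mat_prod n Cs \<in> carrier_mat n n" "C \<in> carrier_mat n n"
    by (auto intro: mat_prod_carrier)
  then show ?case using Cons D by (simp add: assoc_mult_mat[of C n n _ n D n])
qed

lemma mat_prod_inv_rev:
  assumes "\<forall>B\<in>set Bs. B \<in> carrier_mat n n \<and> invertible_mat B"
  shows "mat_prod n (map mat_inv (rev Bs)) * mat_prod n Bs = 1\<^sub>m n"
  using assms
proof (induction Bs)
  case Nil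
  then show ?case by simp
next
  case (Cons B Bs)
  have B: "B \<in> carrier_mat n n" "invertible_mat B" using Cons.prems by auto
  note inv = mat_inv_works[OF B]
  have set: "set (map mat_inv (rev Bs)) \<subseteq> carrier_mat n n"
    using Cons.prems by (auto intro!: mat_inv_works(3))
  let ?Q = "mat_prod n (map mat_inv (rev Bs))" and ?P = "mat_prod n Bs"
  have Q: "?Q \<in> carrier_mat n n" using set by (rule mat_prod_carrier)
  have P: "?P \<in> carrier_mat n n" using Cons.prems by (auto intro: mat_prod_carrier)
  have "mat_prod n (map mat_inv (rev (B # Bs))) * mat_prod n (B # Bs)
      = (?Q * mat_inv B) * (B * ?P)"
    using mat_prod_snoc[OF set inv(3)] by simp
  also have "\<dots> = ?Q * (mat_inv B * (B * ?P))"
    using Q P inv(3) B(1) by (intro assoc_mult_mat[where n\<^sub>4 = n]) auto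
  also have "mat_inv B * (B * ?P) = (mat_inv B * B) * ?P"
    using P inv(3) B(1) by (intro assoc_mult_mat[where n\<^sub>4 = n, symmetric]) auto
  also have "?Q * \<dots> = 1\<^sub>m n"
    using Cons P by (simp add: inv(2))
  finally show ?case .
qed

section \<open>Componentwise relative perturbation of a product\<close>

definition perturbed :: "nat \<Rightarrow> real \<Rightarrow> real mat \<Rightarrow> real mat \<Rightarrow> bool" where
  "perturbed n \<epsilon> C C' \<longleftrightarrow> C \<in> carrier_mat n n \<and> C' \<in> carrier_mat n n \<and>
     (\<forall>i<n. \<forall>j<n. \<bar>C' $$ (i, j) - C $$ (i, j)\<bar> \<le> \<epsilon> * \<bar>C $$ (i, j)\<bar>)"

lemma abs_mat_prod_le:
  assumes "set Cs \<subseteq> carrier_mat n n" "i < n" "j < n"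
  shows "\<bar>mat_prod n Cs $$ (i, j)\<bar> \<le> mat_prod n (map mat_abs Cs) $$ (i, j)"
  using assms
proof (induction Cs arbitrary: i)
  case Nil
  then show ?case by simp
next
  case (Cons C Cs)
  have C: "C \<in> carrier_mat n n" "mat_abs C \<in> carrier_mat n n"
    and P: "mat_prod n Cs \<in> carrier_mat n n" "mat_prod n (map mat_abs Cs) \<in> carrier_mat n n"
    using Cons.prems by (auto intro!: mat_prod_carrier simp: image_subset_iff subset_iff)
  have "\<bar>\<Sum>l<n. C $$ (i, l) * mat_prod n Cs $$ (l, j)\<bar>
      \<le> (\<Sum>l<n. \<bar>C $$ (i, l)\<bar> * mat_prod n (map mat_abs Cs) $$ (l, j))"
    using Cons by (intro order_trans[OF sum_abs] sum_mono) (auto simp: abs_mult intro!: mult_left_mono)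
  then show ?case
    using mult_mat_entry[OF C(1) P(1)] mult_mat_entry[OF C(2) P(2)] C Cons.prems
    by (simp del: index_mult_mat(1))
qed

text \<open>
  Induction on the number of factors, splitting \<open>D P' - C P\<close> as \<open>(D - C) P' + C (P' - P)\<close>.
  In absolute value, the factor \<open>P'\<close> in the first term is at most \<open>(1 + \<epsilon>) ^ k\<close> times the product of the absolute
  values, which makes the two contributions add up exactly to the next power.
\<close>

lemma mat_prod_perturbed:
  assumes "list_all2 (perturbed n \<epsilon>) Cs Ds" "0 \<le> \<epsilon>" "i < n" "j < n"
  shows "\<bar>mat_prod n Ds $$ (i, j) - mat_prod n Cs $$ (i, j)\<bar>
    \<le> ((1 + \<epsilon>) ^ length Cs - 1) * mat_prod n (map mat_abs Cs) $$ (i, j)"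
  using assms(1,3)
proof (induction arbitrary: i rule: list_all2_induct)
  case Nil
  then show ?case by simp
next
  case (Cons C Cs D Ds)
  let ?P = "mat_prod n Cs" and ?P' = "mat_prod n Ds" and ?Q = "mat_prod n (map mat_abs Cs)"
  let ?g = "(1 + \<epsilon>) ^ length Cs"
  have mem: "set Cs \<subseteq> carrier_mat n n" "set Ds \<subseteq> carrier_mat n n"
    using Cons.hyps(2) by (auto simp: list_all2_conv_all_nth in_set_conv_nth perturbed_def)
  have C: "C \<in> carrier_mat n n" "mat_abs C \<in> carrier_mat n n" "D \<in> carrier_mat n n"
    and P: "?P \<in> carrier_mat n n" "?P' \<in> carrier_mat n n" "?Q \<in> carrier_mat n n"
    using Cons.hyps(1) mem
    by (auto intro!: mat_prod_carrier simp: perturbed_def image_subset_iff subset_iff)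
  have summand: "\<bar>D $$ (i, l) * ?P' $$ (l, j) - C $$ (i, l) * ?P $$ (l, j)\<bar>
      \<le> (\<bar>C $$ (i, l)\<bar> * ?Q $$ (l, j)) * ((1 + \<epsilon>) * ?g - 1)" if "l < n" for l
  proof -
    have IH: "\<bar>?P' $$ (l, j) - ?P $$ (l, j)\<bar> \<le> (?g - 1) * ?Q $$ (l, j)"
      using Cons.IH that by auto
    have le: "\<bar>?P $$ (l, j)\<bar> \<le> ?Q $$ (l, j)"
      using abs_mat_prod_le[OF mem(1) that \<open>j < n\<close>] by simp
    have "\<bar>?P' $$ (l, j)\<bar> \<le> \<bar>?P' $$ (l, j) - ?P $$ (l, j)\<bar> + \<bar>?P $$ (l, j)\<bar>" by linarith
    also have "\<dots> \<le> (?g - 1) * ?Q $$ (l, j) + ?Q $$ (l, j)" using IH le by linarith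
    also have "\<dots> = ?g * ?Q $$ (l, j)" by (simp add: algebra_simps)
    finally have P': "\<bar>?P' $$ (l, j)\<bar> \<le> ?g * ?Q $$ (l, j)" .
    have "D $$ (i, l) * ?P' $$ (l, j) - C $$ (i, l) * ?P $$ (l, j)
        = (D $$ (i, l) - C $$ (i, l)) * ?P' $$ (l, j)
          + C $$ (i, l) * (?P' $$ (l, j) - ?P $$ (l, j))"
      by (simp add: algebra_simps)
    then have "\<bar>D $$ (i, l) * ?P' $$ (l, j) - C $$ (i, l) * ?P $$ (l, j)\<bar>
        \<le> \<bar>D $$ (i, l) - C $$ (i, l)\<bar> * \<bar>?P' $$ (l, j)\<bar>
          + \<bar>C $$ (i, l)\<bar> * \<bar>?P' $$ (l, j) - ?P $$ (l, j)\<bar>"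
      by (metis abs_mult abs_triangle_ineq)
    also have "\<dots> \<le> (\<epsilon> * \<bar>C $$ (i, l)\<bar>) * (?g * ?Q $$ (l, j))
        + \<bar>C $$ (i, l)\<bar> * ((?g - 1) * ?Q $$ (l, j))"
      using Cons.hyps(1) Cons.prems that P' IH \<open>0 \<le> \<epsilon>\<close>
      by (intro add_mono mult_mono) (auto simp: perturbed_def)
    also have "\<dots> = (\<bar>C $$ (i, l)\<bar> * ?Q $$ (l, j)) * ((1 + \<epsilon>) * ?g - 1)"
      by (simp add: algebra_simps)
    finally show ?thesis .
  qed
  have "\<bar>(\<Sum>l<n. D $$ (i, l) * ?P' $$ (l, j)) - (\<Sum>l<n. C $$ (i, l) * ?P $$ (l, j))\<bar>
      \<le> (\<Sum>l<n. (\<bar>C $$ (i, l)\<bar> * ?Q $$ (l, j)) * ((1 + \<epsilon>) * ?g - 1))"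
    unfolding sum_subtractf[symmetric]
    by (intro order_trans[OF sum_abs] sum_mono summand) auto
  then show ?case
    using mult_mat_entry[OF C(1) P(1)] mult_mat_entry[OF C(2) P(3)] mult_mat_entry[OF C(3) P(2)]
      C Cons.prems \<open>j < n\<close>
    by (simp add: sum_distrib_left mult.commute del: index_mult_mat(1))
qed

lemma mat_prod_perturbed_mult_vec:
  assumes "list_all2 (perturbed n \<epsilon>) Cs Ds" "0 \<le> \<epsilon>" and z: "z \<in> carrier_vec n"
  shows "vec_abs (mat_prod n Ds *\<^sub>v z - mat_prod n Cs *\<^sub>v z)
    \<le> ((1 + \<epsilon>) ^ length Cs - 1) \<cdot>\<^sub>v (mat_prod n (map mat_abs Cs) *\<^sub>v vec_abs z)"
proof -
  let ?P = "mat_prod n Cs" and ?P' = "mat_prod n Ds" and ?Q = "mat_prod n (map mat_abs Cs)"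
  let ?h = "(1 + \<epsilon>) ^ length Cs - 1"
  have mem: "set Cs \<subseteq> carrier_mat n n" "set Ds \<subseteq> carrier_mat n n"
    using assms(1) by (auto simp: list_all2_conv_all_nth in_set_conv_nth perturbed_def)
  have P: "?P \<in> carrier_mat n n" "?P' \<in> carrier_mat n n" "?Q \<in> carrier_mat n n"
    using mem by (auto intro!: mat_prod_carrier simp: image_subset_iff subset_iff)
  have "\<bar>(\<Sum>l<n. ?P' $$ (i, l) * z $ l) - (\<Sum>l<n. ?P $$ (i, l) * z $ l)\<bar>
      \<le> ?h * (\<Sum>l<n. ?Q $$ (i, l) * \<bar>z $ l\<bar>)" if "i < n" for i
  proof -
    have "\<bar>(\<Sum>l<n. ?P' $$ (i, l) * z $ l) - (\<Sum>l<n. ?P $$ (i, l) * z $ l)\<bar>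
        \<le> (\<Sum>l<n. \<bar>?P' $$ (i, l) - ?P $$ (i, l)\<bar> * \<bar>z $ l\<bar>)"
      unfolding sum_subtractf[symmetric] left_diff_distrib[symmetric] abs_mult[symmetric]
      by (rule sum_abs)
    also have "\<dots> \<le> (\<Sum>l<n. (?h * ?Q $$ (i, l)) * \<bar>z $ l\<bar>)"
      using mat_prod_perturbed[OF assms(1,2)] that by (intro sum_mono mult_right_mono) auto
    also have "\<dots> = ?h * (\<Sum>l<n. ?Q $$ (i, l) * \<bar>z $ l\<bar>)"
      by (simp add: sum_distrib_left mult.assoc)
    finally show ?thesis .
  qed
  then show ?thesis using P z
    by (auto simp: less_eq_vec_def mult_mat_vec_entry[of _ n] simp del: index_mult_mat_vec)
qed

section \<open>Sign patterns\<close>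

text \<open>
  The free global sign \<open>s\<close> accounts for the two alternatives in \<^const>\<open>checkerboard\<close>.
\<close>

definition sign_pattern :: "nat \<Rightarrow> (nat \<Rightarrow> real) \<Rightarrow> real mat \<Rightarrow> bool" where
  "sign_pattern n \<sigma> C \<longleftrightarrow> (\<exists>s. \<bar>s\<bar> = 1 \<and> (\<forall>i<n. \<forall>j<n. s * \<sigma> i * \<sigma> j * C $$ (i, j) \<ge> 0))"

lemma abs_one_square: "\<bar>t :: real\<bar> = 1 \<Longrightarrow> t * t = 1"
  by (metis abs_mult_self mult_1)

lemma abs_eq_signed:
  fixes t c :: real
  assumes "\<bar>t\<bar> = 1" "0 \<le> t * c"
  shows "\<bar>c\<bar> = t * c"
  using assms by (metis abs_mult abs_of_nonneg mult_1)

text \<open>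
  In \<open>\<Sum>l. C i l * D l j\<close> the intermediate sign \<open>\<sigma> l\<close> occurs twice and cancels, so no
  cancellation between terms can occur.
\<close>

lemma sign_pattern_mult:
  assumes \<sigma>: "\<forall>i. \<bar>\<sigma> i\<bar> = 1" and C: "C \<in> carrier_mat n n" "sign_pattern n \<sigma> C"
    and D: "D \<in> carrier_mat n n" "sign_pattern n \<sigma> D"
  shows "sign_pattern n \<sigma> (C * D)" "mat_abs (C * D) = mat_abs C * mat_abs D"
proof -
  obtain s where s: "\<bar>s\<bar> = 1" "\<And>i j. i < n \<Longrightarrow> j < n \<Longrightarrow> s * \<sigma> i * \<sigma> j * C $$ (i, j) \<ge> 0"
    using C(2) by (auto simp: sign_pattern_def)
  obtain t where t: "\<bar>t\<bar> = 1" "\<And>i j. i < n \<Longrightarrow> j < n \<Longrightarrow> t * \<sigma> i * \<sigma> j * D $$ (i, j) \<ge> 0"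
    using D(2) by (auto simp: sign_pattern_def)
  have absC: "\<bar>C $$ (i, j)\<bar> = s * \<sigma> i * \<sigma> j * C $$ (i, j)" if "i < n" "j < n" for i j
    using s \<sigma> that by (intro abs_eq_signed) (auto simp: abs_mult)
  have absD: "\<bar>D $$ (i, j)\<bar> = t * \<sigma> i * \<sigma> j * D $$ (i, j)" if "i < n" "j < n" for i j
    using t \<sigma> that by (intro abs_eq_signed) (auto simp: abs_mult)
  have eq: "(mat_abs C * mat_abs D) $$ (i, j) = (s * t) * \<sigma> i * \<sigma> j * (C * D) $$ (i, j)"
    if ij: "i < n" "j < n" for i j
  proof -
    have "(mat_abs C * mat_abs D) $$ (i, j) = (\<Sum>l<n. \<bar>C $$ (i, l)\<bar> * \<bar>D $$ (l, j)\<bar>)"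
      using ij C D by (subst mult_mat_entry[of _ n]) auto
    also have "\<dots> = (\<Sum>l<n. (s * t) * \<sigma> i * \<sigma> j * (C $$ (i, l) * D $$ (l, j)))"
    proof (rule sum.cong[OF refl])
      fix l assume "l \<in> {..<n}"
      then have "\<bar>C $$ (i, l)\<bar> * \<bar>D $$ (l, j)\<bar>
          = (\<sigma> l * \<sigma> l) * ((s * t) * \<sigma> i * \<sigma> j * (C $$ (i, l) * D $$ (l, j)))"
        using absC ij absD by (simp add: algebra_simps)
      then show "\<bar>C $$ (i, l)\<bar> * \<bar>D $$ (l, j)\<bar>
          = (s * t) * \<sigma> i * \<sigma> j * (C $$ (i, l) * D $$ (l, j))"
        by (simp add: abs_one_square[OF \<sigma>[rule_format]])
    qed
    also have "\<dots> = (s * t) * \<sigma> i * \<sigma> j * (C * D) $$ (i, j)"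
      using ij C D by (subst mult_mat_entry[of _ n]) (auto simp: sum_distrib_left)
    finally show ?thesis .
  qed
  have nonneg: "(s * t) * \<sigma> i * \<sigma> j * (C * D) $$ (i, j) \<ge> 0" if ij: "i < n" "j < n" for i j
  proof -
    have "(mat_abs C * mat_abs D) $$ (i, j) = (\<Sum>l<n. \<bar>C $$ (i, l)\<bar> * \<bar>D $$ (l, j)\<bar>)"
      using ij C D by (subst mult_mat_entry[of _ n]) auto
    then show ?thesis using eq[OF ij] by (simp add: sum_nonneg)
  qed
  show "sign_pattern n \<sigma> (C * D)"
    unfolding sign_pattern_def using nonneg s(1) t(1) by (intro exI[of _ "s * t"]) (auto simp: abs_mult)
  have "\<bar>(C * D) $$ (i, j)\<bar> = (mat_abs C * mat_abs D) $$ (i, j)" if ij: "i < n" "j < n" for i j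
    unfolding eq[OF ij] using nonneg[OF ij] s(1) t(1) \<sigma>
    by (intro abs_eq_signed) (auto simp: abs_mult)
  then show "mat_abs (C * D) = mat_abs C * mat_abs D"
    using C D by (intro eq_matI) (auto simp del: index_mult_mat(1) simp: index_mult_mat(2,3))
qed

lemma mat_abs_mat_prod:
  assumes \<sigma>: "\<forall>i. \<bar>\<sigma> i\<bar> = 1"
    and "\<forall>C\<in>set Cs. C \<in> carrier_mat n n \<and> sign_pattern n \<sigma> C"
  shows "mat_abs (mat_prod n Cs) = mat_prod n (map mat_abs Cs)"
proof -
  have "sign_pattern n \<sigma> (mat_prod n Cs) \<and>
      mat_abs (mat_prod n Cs) = mat_prod n (map mat_abs Cs)"
    using assms(2)
  proof (induction Cs)
    case Nil
    have "sign_pattern n \<sigma> (1\<^sub>m n)"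
      unfolding sign_pattern_def
      by (rule exI[of _ 1]) (auto simp: abs_one_square[OF \<sigma>[rule_format]])
    moreover have "mat_abs (1\<^sub>m n) = (1\<^sub>m n :: real mat)" by (intro eq_matI) auto
    ultimately show ?case by simp
  next
    case (Cons C Cs)
    then have "mat_prod n Cs \<in> carrier_mat n n" by (auto intro: mat_prod_carrier)
    then show ?case using sign_pattern_mult[OF \<sigma>, of C n "mat_prod n Cs"] Cons by simp
  qed
  then show ?thesis ..
qed

section \<open>Bidiagonal matrices\<close>

lemma upper_bidiagonal_zero:
  "upper_bidiagonal B \<Longrightarrow> B \<in> carrier_mat n n \<Longrightarrow> i < n \<Longrightarrow> j < n \<Longrightarrow> j \<noteq> i \<Longrightarrow> j \<noteq> i + 1 \<Longrightarrow>
    B $$ (i, j) = 0"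
  by (auto simp: upper_bidiagonal_def)

lemma lower_bidiagonal_zero:
  "lower_bidiagonal B \<Longrightarrow> B \<in> carrier_mat n n \<Longrightarrow> i < n \<Longrightarrow> j < n \<Longrightarrow> j \<noteq> i \<Longrightarrow> i \<noteq> j + 1 \<Longrightarrow>
    B $$ (i, j) = 0"
  by (auto simp: lower_bidiagonal_def upper_bidiagonal_def)

lemma sum_upper_band:
  fixes f :: "nat \<Rightarrow> real"
  assumes "i < n" "\<And>j. j < n \<Longrightarrow> j \<noteq> i \<Longrightarrow> j \<noteq> i + 1 \<Longrightarrow> f j = 0"
  shows "(\<Sum>j<n. f j) = f i + (if i + 1 < n then f (i + 1) else 0)"
proof -
  have "(\<Sum>j<n. f j) = (\<Sum>j\<in>{i, i + 1} \<inter> {..<n}. f j)"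
    using assms by (intro sum.mono_neutral_right) auto
  also have "{i, i + 1} \<inter> {..<n} = (if i + 1 < n then {i, i + 1} else {i})"
    using assms(1) by auto
  finally show ?thesis by auto
qed

lemma sum_lower_band:
  fixes f :: "nat \<Rightarrow> real"
  assumes "i < n" "\<And>j. j < n \<Longrightarrow> j \<noteq> i \<Longrightarrow> i \<noteq> j + 1 \<Longrightarrow> f j = 0"
  shows "(\<Sum>j<n. f j) = f i + (if 0 < i then f (i - 1) else 0)"
proof -
  have "(\<Sum>j<n. f j) = (\<Sum>j\<in>(if 0 < i then {i, i - 1} else {i}). f j)"
  proof (rule sum.mono_neutral_right)
    show "\<forall>j\<in>{..<n} - (if 0 < i then {i, i - 1} else {i}). f j = 0"
      by (intro ballI assms(2)) (auto split: if_splits)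
  qed (use assms(1) in auto)
  then show ?thesis by auto
qed

lemma upper_bidiagonal_diag_nonzero:
  assumes B: "B \<in> carrier_mat n n" "upper_bidiagonal B"
    and N: "N \<in> carrier_mat n n" "B * N = 1\<^sub>m n" and i: "i < n"
  shows "B $$ (i, i) \<noteq> 0"
proof
  assume "B $$ (i, i) = 0"
  then have "0 \<in> set (diag_mat B)"
    using B(1) i by (force simp: diag_mat_def)
  moreover have "det B = prod_list (diag_mat B)"
    using B by (intro det_upper_triangular) (auto simp: upper_bidiagonal_def)
  ultimately have "det B = 0" by (simp add: prod_list_zero_iff)
  then show False using det_mult[OF B(1) N(1)] N(2) by simp
qed

text \<open>
  Row \<open>i\<close> of \<open>B N = 1\<close> is a two-term recurrence that expresses \<open>N i j\<close> through
  \<open>N (i + 1) j\<close>.  After the signs are removed, it reads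
  \<open>\<bar>B i i\<bar> * m i j - \<bar>B i (i + 1)\<bar> * m (i + 1) j = \<delta>\<close> with \<open>\<delta> \<ge> 0\<close>, because moving one row down
  flips the alternating sign; back substitution from the last row then keeps \<open>m\<close> nonnegative.
\<close>

lemma upper_bidiagonal_inverse_sign_pattern:
  assumes \<sigma>: "\<forall>i. \<bar>\<sigma> i\<bar> = 1"
    and B: "B \<in> carrier_mat n n" "upper_bidiagonal B" "sign_pattern n \<sigma> B"
    and N: "N \<in> carrier_mat n n" "B * N = 1\<^sub>m n"
  shows "sign_pattern n (\<lambda>i. (-1) ^ i * \<sigma> i) N"
proof -
  obtain s where s: "\<bar>s\<bar> = 1" "\<And>i j. i < n \<Longrightarrow> j < n \<Longrightarrow> s * \<sigma> i * \<sigma> j * B $$ (i, j) \<ge> 0"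
    using B(3) by (auto simp: sign_pattern_def)
  have absB: "\<bar>B $$ (i, j)\<bar> = s * \<sigma> i * \<sigma> j * B $$ (i, j)" if "i < n" "j < n" for i j
    using s \<sigma> that by (intro abs_eq_signed) (auto simp: abs_mult)
  define m where "m i j = s * ((-1) ^ i * \<sigma> i) * ((-1) ^ j * \<sigma> j) * N $$ (i, j)" for i j
  have "m i j \<ge> 0" if "i < n" "j < n" for i j
    using that(1)
  proof (induction "n - i" arbitrary: i rule: less_induct)
    case less
    define c where "c = ((-1) ^ i * \<sigma> i) * ((-1) ^ j * \<sigma> j)"
    have "B $$ (i, i) * N $$ (i, j) + (if i + 1 < n then B $$ (i, i + 1) * N $$ (i + 1, j) else 0)
        = (\<Sum>l<n. B $$ (i, l) * N $$ (l, j))"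
      using less.prems upper_bidiagonal_zero[OF B(2,1)] by (subst sum_upper_band[of i]) auto
    also have "\<dots> = (if i = j then 1 else 0)"
      using mult_mat_entry[OF B(1) N(1) less.prems that(2)] N(2) less.prems that(2) by simp
    finally have "c * (B $$ (i, i) * N $$ (i, j)
        + (if i + 1 < n then B $$ (i, i + 1) * N $$ (i + 1, j) else 0)) = c * (if i = j then 1 else 0)"
      by simp
    moreover have "c * (if i = j then 1 else 0) \<ge> 0"
      by (auto simp: c_def)
    moreover have "\<bar>B $$ (i, i)\<bar> * m i j = c * (B $$ (i, i) * N $$ (i, j))"
    proof -
      have "\<bar>B $$ (i, i)\<bar> * m i j = (s * s) * (\<sigma> i * \<sigma> i) * (c * (B $$ (i, i) * N $$ (i, j)))"
        using absB less.prems by (simp add: m_def c_def)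
      then show ?thesis by (simp add: abs_one_square[OF \<sigma>[rule_format]] abs_one_square[OF s(1)])
    qed
    moreover have "\<bar>B $$ (i, i + 1)\<bar> * m (i + 1) j = - (c * (B $$ (i, i + 1) * N $$ (i + 1, j)))"
      if "i + 1 < n"
    proof -
      have "\<bar>B $$ (i, i + 1)\<bar> * m (i + 1) j
          = - ((s * s) * (\<sigma> (i + 1) * \<sigma> (i + 1)) * (c * (B $$ (i, i + 1) * N $$ (i + 1, j))))"
        using absB[of i "i + 1"] that by (simp add: m_def c_def)
      then show ?thesis by (simp only: abs_one_square[OF \<sigma>[rule_format]] abs_one_square[OF s(1)] mult_1)
    qed
    moreover have "\<bar>B $$ (i, i + 1)\<bar> * m (i + 1) j \<ge> 0" if "i + 1 < n"
      using less.hyps[of "i + 1"] that less.prems by simp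
    ultimately have "\<bar>B $$ (i, i)\<bar> * m i j \<ge> 0"
      by (auto simp: distrib_left split: if_splits)
    then show ?case
      using upper_bidiagonal_diag_nonzero[OF B(1,2) N less.prems]
      by (simp add: zero_le_mult_iff)
  qed
  then show ?thesis
    unfolding sign_pattern_def m_def using s(1) by blast
qed

lemma sign_pattern_transpose:
  assumes "C \<in> carrier_mat n n"
  shows "sign_pattern n \<sigma> (transpose_mat C) \<longleftrightarrow> sign_pattern n \<sigma> C"
proof -
  have "(\<forall>i<n. \<forall>j<n. s * \<sigma> i * \<sigma> j * transpose_mat C $$ (i, j) \<ge> 0) \<longleftrightarrow>
      (\<forall>i<n. \<forall>j<n. s * \<sigma> i * \<sigma> j * C $$ (i, j) \<ge> 0)" for s
  proof -
    have "s * \<sigma> i * \<sigma> j * transpose_mat C $$ (i, j) = s * \<sigma> j * \<sigma> i * C $$ (j, i)"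
      if "i < n" "j < n" for i j
      using assms that by simp
    then show ?thesis by metis
  qed
  then show ?thesis by (simp add: sign_pattern_def)
qed

lemma bidiagonal_inverse_sign_pattern:
  assumes \<sigma>: "\<forall>i. \<bar>\<sigma> i\<bar> = 1"
    and B: "B \<in> carrier_mat n n" "upper_bidiagonal B \<or> lower_bidiagonal B" "sign_pattern n \<sigma> B"
    and N: "N \<in> carrier_mat n n" "B * N = 1\<^sub>m n" "N * B = 1\<^sub>m n"
  shows "sign_pattern n (\<lambda>i. (-1) ^ i * \<sigma> i) N"
  using B(2)
proof
  assume "upper_bidiagonal B"
  then show ?thesis using upper_bidiagonal_inverse_sign_pattern[OF \<sigma>] B N by blast
next
  assume "lower_bidiagonal B"
  then have u: "upper_bidiagonal (transpose_mat B)" by (simp add: lower_bidiagonal_def)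
  have "transpose_mat B * transpose_mat N = 1\<^sub>m n"
    using transpose_mult[OF N(1) B(1)] N(3) by simp
  then have "sign_pattern n (\<lambda>i. (-1) ^ i * \<sigma> i) (transpose_mat N)"
    using B N by (intro upper_bidiagonal_inverse_sign_pattern[OF \<sigma> _ u])
      (auto simp: sign_pattern_transpose)
  then show ?thesis using N(1) by (simp add: sign_pattern_transpose)
qed

lemma nonneg_mat_sign_pattern:
  assumes "nonneg_mat C" "C \<in> carrier_mat n n"
  shows "sign_pattern n (\<lambda>_. 1) C"
  unfolding sign_pattern_def
  using assms by (intro exI[of _ 1]) (auto simp: nonneg_mat_def less_eq_mat_def)

lemma checkerboard_sign_pattern:
  assumes "checkerboard C" and C: "C \<in> carrier_mat n n"
  shows "sign_pattern n (\<lambda>i. (-1) ^ i) C"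
proof -
  let ?S = "mat_diag n (\<lambda>i. (-1) ^ i) :: real mat"
  have entry: "(?S * mat_abs C * ?S) $$ (i, j) = (-1) ^ i * (-1) ^ j * \<bar>C $$ (i, j)\<bar>"
    if "i < n" "j < n" for i j
  proof -
    have "mat_abs C \<in> carrier_mat n n" using C by simp
    then have "?S * mat_abs C = mat n n (\<lambda>(i, j). (-1) ^ i * \<bar>C $$ (i, j)\<bar>)"
      using C by (subst mat_diag_mult_left[of _ n n]) (auto intro!: eq_matI)
    then show ?thesis
      using that by (subst mat_diag_mult_right[of _ n n]) auto
  qed
  have dims: "dim_row (?S * mat_abs C * ?S) = n" "dim_col (?S * mat_abs C * ?S) = n"
    by (auto simp: mat_diag_def)
  from assms consider "C = ?S * mat_abs C * ?S" | "C = - (?S * mat_abs C * ?S)"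
    by (auto simp: checkerboard_def Let_def)
  then obtain s :: real where s: "\<bar>s\<bar> = 1"
    "\<And>i j. i < n \<Longrightarrow> j < n \<Longrightarrow> C $$ (i, j) = s * ((-1) ^ i * (-1) ^ j * \<bar>C $$ (i, j)\<bar>)"
  proof cases
    case 1
    then have "C $$ (i, j) = 1 * ((-1) ^ i * (-1) ^ j * \<bar>C $$ (i, j)\<bar>)" if "i < n" "j < n" for i j
      using entry[OF that] by simp
    then show ?thesis using that[of 1] by simp
  next
    case 2
    have "C $$ (i, j) = (-1) * ((-1) ^ i * (-1) ^ j * \<bar>C $$ (i, j)\<bar>)" if "i < n" "j < n" for i j
    proof -
      have "C $$ (i, j) = (- (?S * mat_abs C * ?S)) $$ (i, j)" using 2 by simp
      also have "\<dots> = - ((?S * mat_abs C * ?S) $$ (i, j))"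
        using dims that by (intro index_uminus_mat) auto
      finally show ?thesis using entry[OF that] by simp
    qed
    then show ?thesis using that[of "-1"] by simp
  qed
  have "0 \<le> s * (-1) ^ i * (-1) ^ j * C $$ (i, j)" if "i < n" "j < n" for i j
  proof -
    have "s * (-1) ^ i * (-1) ^ j * C $$ (i, j)
        = (s * s) * ((-1) ^ i * (-1) ^ i) * ((-1) ^ j * (-1) ^ j) * \<bar>C $$ (i, j)\<bar>"
      using arg_cong[OF s(2)[OF that], of "\<lambda>c. s * (-1) ^ i * (-1) ^ j * c"]
      by (simp only: mult_ac)
    also have "\<dots> = \<bar>C $$ (i, j)\<bar>"
      by (simp add: abs_one_square[OF s(1)] power_mult_distrib[symmetric])
    finally show ?thesis by simp
  qed
  then show ?thesis unfolding sign_pattern_def using s(1) by blast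
qed

section \<open>Diagonal scalings that realise relative perturbations of a bidiagonal matrix\<close>

text \<open>
  What products and quotients of \<open>m\<close> numbers in \<open>[1 - g, 1 + g]\<close> satisfy.  The upper bound
  \<open>1 / (1 - g) ^ m\<close>, weaker than \<open>(1 + g) ^ m\<close>, makes the condition symmetric under inversion.
\<close>

definition rel_factor :: "real \<Rightarrow> nat \<Rightarrow> real \<Rightarrow> bool" where
  "rel_factor g m p \<longleftrightarrow> (1 - g) ^ m \<le> p \<and> p \<le> 1 / (1 - g) ^ m"

lemma rel_factor_pos: "rel_factor g m p \<Longrightarrow> g < 1 \<Longrightarrow> 0 < p"
  by (smt (verit) rel_factor_def zero_less_power)

lemma rel_factor_one_plus:
  assumes "\<bar>e - 1\<bar> \<le> g" "0 \<le> g" "g < 1"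
  shows "rel_factor g 1 e"
proof -
  have "e * (1 - g) \<le> (1 + g) * (1 - g)" using assms by (intro mult_right_mono) auto
  also have "\<dots> \<le> 1" by (simp add: algebra_simps)
  finally show ?thesis using assms by (auto simp: rel_factor_def field_simps)
qed

lemma rel_factor_mult:
  assumes "rel_factor g m p" "rel_factor g l q" "g < 1"
  shows "rel_factor g (m + l) (p * q)"
proof -
  have pos: "0 < p" "0 < q" "0 < (1 - g) ^ m" "0 < (1 - g) ^ l"
    using assms by (auto intro: rel_factor_pos)
  have "(1 - g) ^ m * (1 - g) ^ l \<le> p * q" "p * q \<le> (1 / (1 - g) ^ m) * (1 / (1 - g) ^ l)"
    using assms pos unfolding rel_factor_def
    by (auto simp del: times_divide_eq_left times_divide_eq_right
        intro!: mult_mono less_imp_le[OF pos(1)] less_imp_le[OF pos(2)])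
  then show ?thesis by (simp add: rel_factor_def power_add)
qed

lemma rel_factor_inverse:
  assumes "rel_factor g m p" "g < 1"
  shows "rel_factor g m (1 / p)"
proof -
  have "0 < p" "0 < (1 - g) ^ m" using assms by (auto intro: rel_factor_pos)
  then show ?thesis using assms(1) by (auto simp: rel_factor_def field_simps)
qed

lemma rel_factor_mono:
  assumes "rel_factor g m p" "m \<le> l" "0 \<le> g" "g < 1"
  shows "rel_factor g l p"
proof -
  have "(1 - g) ^ l \<le> (1 - g) ^ m" using assms by (intro power_decreasing) auto
  moreover have "1 / (1 - g) ^ m \<le> 1 / (1 - g) ^ l"
    using assms calculation by (intro divide_left_mono) auto
  ultimately show ?thesis using assms(1) by (auto simp: rel_factor_def)
qed

lemma rel_factor_dist_one:
  assumes "rel_factor g m p" "0 \<le> g" "g < 1" "real m * g < 1"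
  shows "\<bar>p - 1\<bar> \<le> real m * g / (1 - real m * g)"
proof -
  have bern: "1 - real m * g \<le> (1 - g) ^ m"
    using Bernoulli_inequality[of "- g" m] assms by simp
  have "p \<le> 1 / (1 - g) ^ m" using assms by (simp add: rel_factor_def)
  also have "\<dots> \<le> 1 / (1 - real m * g)" using bern assms by (intro divide_left_mono) auto
  finally have "p - 1 \<le> real m * g / (1 - real m * g)" using assms(4) by (simp add: field_simps)
  moreover have "1 - p \<le> real m * g" using assms(1) bern by (simp add: rel_factor_def)
  moreover have "real m * g * (1 - real m * g) \<le> real m * g * 1"
    using assms by (intro mult_left_mono) auto
  then have "real m * g \<le> real m * g / (1 - real m * g)"
    using assms(4) by (simp add: pos_le_divide_eq)
  ultimately show ?thesis by linarith
qed

text \<open>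
  Potentials on the vertices \<open>0, 1, 2, \<dots>\<close> of a path whose products over adjacent vertices are
  the prescribed edge factors \<open>e\<close>.
\<close>

primrec path_scaling :: "(nat \<Rightarrow> real) \<Rightarrow> nat \<Rightarrow> real" where
  "path_scaling e 0 = 1"
| "path_scaling e (Suc m) = e m / path_scaling e m"

lemma path_scaling_pos: "\<forall>m. 0 < e m \<Longrightarrow> 0 < path_scaling e m"
  by (induction m) auto

lemma path_scaling_edge: "\<forall>m. 0 < e m \<Longrightarrow> path_scaling e m * path_scaling e (Suc m) = e m"
  using path_scaling_pos[of e m] by simp

text \<open>
  For vertices at odd distance, moving the endpoint two edges further multiplies by the last edge
  factor and divides by the one before, so the product of the potentials telescopes into the
  edge factors between them, each used once.
\<close>

lemma path_scaling_rel_factor: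
  assumes e: "\<forall>m. \<bar>e m - 1\<bar> \<le> g" and g: "0 \<le> g" "g < 1"
  shows "rel_factor g (2 * d + 1) (path_scaling e p * path_scaling e (p + 2 * d + 1))"
proof (induction d)
  case 0
  have pos: "\<forall>m. 0 < e m" using e g by (smt (verit))
  show ?case using path_scaling_edge[of e p] pos rel_factor_one_plus[OF e[rule_format] g] by simp
next
  case (Suc d)
  let ?s = "path_scaling e" and ?q = "p + 2 * d + 1"
  have pos: "\<forall>m. 0 < e m" using e g by (smt (verit))
  have "?s (?q + 2) = ?s ?q * (1 / e ?q) * e (?q + 1)"
    using path_scaling_pos[OF pos, of ?q] pos[rule_format, of ?q] by (simp add: mult.commute)
  then have "?s p * ?s (p + 2 * Suc d + 1) = ?s p * ?s ?q * (1 / e ?q) * e (?q + 1)"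
    by (simp add: algebra_simps)
  moreover have "rel_factor g (2 * d + 1 + 1 + 1) (?s p * ?s ?q * (1 / e ?q) * e (?q + 1))"
    using rel_factor_one_plus[OF e[rule_format] g] g(2)
    by (intro rel_factor_mult rel_factor_inverse Suc.IH) auto
  ultimately show ?case by simp
qed

lemma path_scaling_rel_factor_odd:
  assumes e: "\<forall>m. \<bar>e m - 1\<bar> \<le> g" and g: "0 \<le> g" "g < 1"
    and "odd (p + q)" "p \<le> N" "q \<le> N"
  shows "rel_factor g N (path_scaling e p * path_scaling e q)"
proof -
  have *: "rel_factor g N (path_scaling e p * path_scaling e q)"
    if "p < q" "odd (p + q)" "q \<le> N" for p q
  proof -
    have "odd (q - p)" using that by presburger
    then obtain d where "q - p = 2 * d + 1" by (elim oddE)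
    then have "q = p + 2 * d + 1" using that(1) by simp
    then show ?thesis
      using path_scaling_rel_factor[OF e g, of d p] g that(3)
      by (auto intro: rel_factor_mono)
  qed
  consider "p < q" | "q < p" using assms(4) by (cases p q rule: linorder_cases) auto
  then show ?thesis
    using *[of p q] *[of q p] assms(4-6) by cases (auto simp: mult.commute add.commute)
qed

text \<open>
  The path visits \<open>p 0, q 0, p 1, q 1, \<dots>\<close>, alternating between columns and rows.  For an upper
  bidiagonal matrix it starts at the first column (\<open>p\<close> scales columns, \<open>q\<close> rows), for a lower
  bidiagonal one at the first row (\<open>p\<close> scales rows, \<open>q\<close> columns).  The \<open>2n\<close> vertices span at most \<open>2n - 1\<close> edges.
\<close>

lemma band_scaling:
  fixes d e :: "nat \<Rightarrow> real"
  assumes d: "\<forall>i. \<bar>d i - 1\<bar> \<le> g" and e: "\<forall>i. \<bar>e i - 1\<bar> \<le> g" and g: "0 \<le> g" "g < 1"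
  obtains p q :: "nat \<Rightarrow> real" where
    "\<And>i. 0 < p i" "\<And>i. 0 < q i" "\<And>i. p i * q i = d i" "\<And>i. q i * p (i + 1) = e i"
    "\<And>i j n. i < n \<Longrightarrow> j < n \<Longrightarrow> rel_factor g (2 * n - 1) (1 / (p i * q j))"
proof -
  define f where "f m = (if even m then d (m div 2) else e (m div 2))" for m
  have f: "\<forall>m. \<bar>f m - 1\<bar> \<le> g" using d e by (auto simp: f_def)
  have pos: "\<forall>m. 0 < f m" using f g by (smt (verit))
  define p where "p i = path_scaling f (2 * i)" for i
  define q where "q i = path_scaling f (2 * i + 1)" for i
  have f_even: "f (2 * i) = d i" and f_odd: "f (2 * i + 1) = e i" for i by (auto simp: f_def)
  show ?thesis
  proof
    show "0 < p i" "0 < q i" for i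
      unfolding p_def q_def using path_scaling_pos[of f] pos by blast+
    show "p i * q i = d i" for i
      unfolding p_def q_def f_even[symmetric]
      using path_scaling_edge[OF pos, of "2 * i"] by (simp del: path_scaling.simps)
    show "q i * p (i + 1) = e i" for i
      unfolding p_def q_def f_odd[symmetric]
      using path_scaling_edge[OF pos, of "2 * i + 1"] by (simp del: path_scaling.simps)
    show "rel_factor g (2 * n - 1) (1 / (p i * q j))" if "i < n" "j < n" for i j n
      unfolding p_def q_def using that
      by (intro rel_factor_inverse[OF path_scaling_rel_factor_odd[OF f g] g(2)]) auto
  qed
qed

section \<open>One computed matrix-vector product\<close>

text \<open>Two roundings stay within \<open>2 * u + u\<^sup>2 \<le> gamma2 u\<close>.\<close>

lemma gamma2_bounds:
  assumes "0 \<le> u" "2 * u < 1" "\<bar>\<delta>\<bar> \<le> u" "\<bar>\<delta>'\<bar> \<le> u"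
  shows "0 \<le> gamma2 u" "\<bar>(1 + \<delta>) * (1 + \<delta>') - 1\<bar> \<le> gamma2 u" "\<bar>(1 + \<delta>) - 1\<bar> \<le> gamma2 u"
proof -
  have "2 * u * (1 - 2 * u) + u * u * (1 - 2 * u) \<le> 2 * u"
    using assms by (simp add: algebra_simps)
  then have ge: "2 * u + u * u \<le> gamma2 u"
    using assms by (simp add: gamma2_def pos_le_divide_eq algebra_simps)
  have uu: "0 \<le> u * u" by simp
  then show "0 \<le> gamma2 u" using ge assms(1) by linarith
  have "\<bar>\<delta> * \<delta>'\<bar> \<le> u * u" unfolding abs_mult using assms by (intro mult_mono) auto
  then show "\<bar>(1 + \<delta>) * (1 + \<delta>') - 1\<bar> \<le> gamma2 u"
    using assms ge by (simp add: algebra_simps)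
  show "\<bar>(1 + \<delta>) - 1\<bar> \<le> gamma2 u" using assms ge uu by linarith
qed

lemma fl_Mul:
  assumes "standard_model u F fl" "0 \<le> u" "2 * u < 1" "a \<in> F" "v \<in> F"
  shows "fl Mul a v \<in> F" "\<exists>d. \<bar>d - 1\<bar> \<le> gamma2 u \<and> fl Mul a v = a * d * v"
proof -
  from assms(1,4,5) obtain \<delta> where "fl Mul a v \<in> F" "\<bar>\<delta>\<bar> \<le> u" "fl Mul a v = a * v * (1 + \<delta>)"
    unfolding standard_model_def by (metis exact.simps(3) fp_op.distinct(11))
  then show "fl Mul a v \<in> F" "\<exists>d. \<bar>d - 1\<bar> \<le> gamma2 u \<and> fl Mul a v = a * d * v"
    using gamma2_bounds(3)[OF assms(2,3), of \<delta> \<delta>]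
    by (auto intro!: exI[of _ "1 + \<delta>"] simp: algebra_simps)
qed

lemma fl_two_term:
  assumes model: "standard_model u F fl" and u: "0 \<le> u" "2 * u < 1"
    and F: "a \<in> F" "v \<in> F" "a' \<in> F" "v' \<in> F"
  shows "fl Add (fl Mul a v) (fl Mul a' v') \<in> F"
    "\<exists>d d'. \<bar>d - 1\<bar> \<le> gamma2 u \<and> \<bar>d' - 1\<bar> \<le> gamma2 u \<and>
      fl Add (fl Mul a v) (fl Mul a' v') = a * d * v + a' * d' * v'"
proof -
  from model F(1,2) obtain \<delta> where 1: "fl Mul a v \<in> F" "\<bar>\<delta>\<bar> \<le> u" "fl Mul a v = a * v * (1 + \<delta>)"
    unfolding standard_model_def by (metis exact.simps(3) fp_op.distinct(11))
  from model F(3,4) obtain \<delta>' where 2: "fl Mul a' v' \<in> F" "\<bar>\<delta>'\<bar> \<le> u"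
      "fl Mul a' v' = a' * v' * (1 + \<delta>')"
    unfolding standard_model_def by (metis exact.simps(3) fp_op.distinct(11))
  from model 1(1) 2(1) obtain \<eta> where 3: "fl Add (fl Mul a v) (fl Mul a' v') \<in> F" "\<bar>\<eta>\<bar> \<le> u"
      "fl Add (fl Mul a v) (fl Mul a' v') = (fl Mul a v + fl Mul a' v') * (1 + \<eta>)"
    unfolding standard_model_def by (metis exact.simps(1) fp_op.distinct(5))
  show "fl Add (fl Mul a v) (fl Mul a' v') \<in> F" by fact
  show "\<exists>d d'. \<bar>d - 1\<bar> \<le> gamma2 u \<and> \<bar>d' - 1\<bar> \<le> gamma2 u \<and>
      fl Add (fl Mul a v) (fl Mul a' v') = a * d * v + a' * d' * v'"
    using gamma2_bounds(2)[OF u 1(2) 3(2)] gamma2_bounds(2)[OF u 2(2) 3(2)]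
    unfolding 3(3) unfolding 1(3) 2(3)
    by (intro exI[of _ "(1 + \<delta>) * (1 + \<eta>)"] exI[of _ "(1 + \<delta>') * (1 + \<eta>)"])
       (simp add: algebra_simps)
qed

text \<open>From index \<open>n\<close> on the factors are taken to be \<open>1\<close>, so that the bounds hold for all indices.\<close>

lemma choose_band_factors:
  fixes g :: real
  assumes "0 \<le> g" "\<And>i. i < n \<Longrightarrow> \<exists>d e. \<bar>d - 1\<bar> \<le> g \<and> \<bar>e - 1\<bar> \<le> g \<and> P i d e"
  obtains d e :: "nat \<Rightarrow> real" where
    "\<forall>i. \<bar>d i - 1\<bar> \<le> g" "\<forall>i. \<bar>e i - 1\<bar> \<le> g" "\<And>i. i < n \<Longrightarrow> P i (d i) (e i)"
proof -
  have "\<exists>d e. \<bar>d - 1\<bar> \<le> g \<and> \<bar>e - 1\<bar> \<le> g \<and> (i < n \<longrightarrow> P i d e)" for i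
    using assms by (cases "i < n") (auto intro!: exI[of _ 1])
  then show ?thesis using that by metis
qed

lemma computed_mult_vec_scaling:
  assumes B: "B \<in> carrier_mat n n" and v: "v \<in> carrier_vec n"
    and model: "standard_model u F fl" and u: "0 \<le> u" "2 * u < 1" "gamma2 u < 1"
    and BF: "\<forall>i<n. \<forall>j<n. B $$ (i, j) \<in> F" and vF: "\<forall>i<n. v $ i \<in> F"
    and y: "computed_mult_vec fl B v y"
  shows "y \<in> carrier_vec n" "\<forall>i<n. y $ i \<in> F"
    "\<exists>r c. (\<forall>i. 0 < r i \<and> 0 < c i) \<and>
       (\<forall>i<n. y $ i = (\<Sum>j<n. r i * B $$ (i, j) * c j * v $ j)) \<and>
       (\<forall>i<n. \<forall>j<n. B $$ (i, j) \<noteq> 0 \<longrightarrow> \<bar>r i * c j - 1\<bar> \<le> gamma2 u) \<and>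
       (\<forall>i<n. \<forall>j<n. rel_factor (gamma2 u) (2 * n - 1) (1 / (r i * c j)))"
proof -
  note mul = fl_Mul[OF model u(1,2)] and two = fl_two_term[OF model u(1,2)]
  have g: "0 \<le> gamma2 u" using gamma2_bounds(1)[OF u(1,2), of 0 0] u(1) by simp
  show "y \<in> carrier_vec n"
    using y B by (auto simp: computed_mult_vec_def fl_upper_mult_vec_def fl_lower_mult_vec_def)
  show "\<forall>i<n. y $ i \<in> F"
    using y B BF vF
    by (auto simp: computed_mult_vec_def fl_upper_mult_vec_def fl_lower_mult_vec_def
        intro!: mul(1) two(1))
  show "\<exists>r c. (\<forall>i. 0 < r i \<and> 0 < c i) \<and>
       (\<forall>i<n. y $ i = (\<Sum>j<n. r i * B $$ (i, j) * c j * v $ j)) \<and>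
       (\<forall>i<n. \<forall>j<n. B $$ (i, j) \<noteq> 0 \<longrightarrow> \<bar>r i * c j - 1\<bar> \<le> gamma2 u) \<and>
       (\<forall>i<n. \<forall>j<n. rel_factor (gamma2 u) (2 * n - 1) (1 / (r i * c j)))"
    using y unfolding computed_mult_vec_def
  proof (elim disjE conjE)
    assume up: "upper_bidiagonal B" and y: "y = fl_upper_mult_vec fl B v"
    note zero = upper_bidiagonal_zero[OF up B]
    have "\<exists>d e. \<bar>d - 1\<bar> \<le> gamma2 u \<and> \<bar>e - 1\<bar> \<le> gamma2 u \<and>
        y $ i = B $$ (i, i) * d * v $ i
          + (if i + 1 < n then B $$ (i, i + 1) * e * v $ (i + 1) else 0)" if i: "i < n" for i
    proof (cases "i + 1 < n")
      case True
      then show ?thesis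
        using B i two(2)[of "B $$ (i, i)" "v $ i" "B $$ (i, i + 1)" "v $ (i + 1)"] BF vF
        by (simp add: y fl_upper_mult_vec_def)
    next
      case False
      obtain d where "\<bar>d - 1\<bar> \<le> gamma2 u" "fl Mul (B $$ (i, i)) (v $ i) = B $$ (i, i) * d * v $ i"
        using mul(2)[of "B $$ (i, i)" "v $ i"] BF vF i by blast
      then show ?thesis
        using False B i g by (intro exI[of _ d] exI[of _ 1]) (simp add: y fl_upper_mult_vec_def)
    qed
    then obtain d e where de: "\<forall>i. \<bar>d i - 1\<bar> \<le> gamma2 u" "\<forall>i. \<bar>e i - 1\<bar> \<le> gamma2 u"
      "\<And>i. i < n \<Longrightarrow> y $ i = B $$ (i, i) * d i * v $ i
          + (if i + 1 < n then B $$ (i, i + 1) * e i * v $ (i + 1) else 0)"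
      using choose_band_factors[OF g, of n "\<lambda>i d e. y $ i = B $$ (i, i) * d * v $ i
          + (if i + 1 < n then B $$ (i, i + 1) * e * v $ (i + 1) else 0)"] by metis
    obtain c r :: "nat \<Rightarrow> real" where cr: "\<And>i. 0 < c i" "\<And>i. 0 < r i"
      "\<And>i. c i * r i = d i" "\<And>i. r i * c (i + 1) = e i"
      "\<And>i j n. i < n \<Longrightarrow> j < n \<Longrightarrow> rel_factor (gamma2 u) (2 * n - 1) (1 / (c i * r j))"
      using band_scaling[OF de(1,2) g u(3)] by metis
    have "y $ i = (\<Sum>j<n. r i * B $$ (i, j) * c j * v $ j)" if i: "i < n" for i
      unfolding de(3)[OF i] cr(3,4)[symmetric] using i
      by (subst sum_upper_band[of i]) (auto simp: zero)
    moreover have "\<bar>r i * c j - 1\<bar> \<le> gamma2 u" if "i < n" "j < n" "B $$ (i, j) \<noteq> 0" for i j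
    proof -
      have "j = i \<or> j = i + 1" using zero that by blast
      then show ?thesis using de(1,2) by (auto simp flip: cr(3,4) simp: mult.commute)
    qed
    ultimately show ?thesis
      using cr(1,2,5) by (intro exI[of _ r] exI[of _ c]) (auto simp: mult.commute)
  next
    assume lo: "lower_bidiagonal B" and y: "y = fl_lower_mult_vec fl B v"
    note zero = lower_bidiagonal_zero[OF lo B]
    have "\<exists>d e. \<bar>d - 1\<bar> \<le> gamma2 u \<and> \<bar>e - 1\<bar> \<le> gamma2 u \<and>
        y $ i = B $$ (i, i) * d * v $ i
          + (if 0 < i then B $$ (i, i - 1) * e * v $ (i - 1) else 0)" if i: "i < n" for i
    proof (cases "0 < i")
      case True
      then obtain d e where "\<bar>d - 1\<bar> \<le> gamma2 u" "\<bar>e - 1\<bar> \<le> gamma2 u"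
        "y $ i = B $$ (i, i - 1) * d * v $ (i - 1) + B $$ (i, i) * e * v $ i"
        using B i two(2)[of "B $$ (i, i - 1)" "v $ (i - 1)" "B $$ (i, i)" "v $ i"] BF vF
        by (auto simp: y fl_lower_mult_vec_def)
      then show ?thesis
        using True by (intro exI[of _ e] exI[of _ d]) auto
    next
      case False
      obtain d where "\<bar>d - 1\<bar> \<le> gamma2 u" "fl Mul (B $$ (i, i)) (v $ i) = B $$ (i, i) * d * v $ i"
        using mul(2)[of "B $$ (i, i)" "v $ i"] BF vF i by blast
      then show ?thesis
        using False B i g by (intro exI[of _ d] exI[of _ 1]) (simp add: y fl_lower_mult_vec_def)
    qed
    then obtain d e where de: "\<forall>i. \<bar>d i - 1\<bar> \<le> gamma2 u" "\<forall>i. \<bar>e i - 1\<bar> \<le> gamma2 u"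
      "\<And>i. i < n \<Longrightarrow> y $ i = B $$ (i, i) * d i * v $ i
          + (if 0 < i then B $$ (i, i - 1) * e i * v $ (i - 1) else 0)"
      using choose_band_factors[OF g, of n "\<lambda>i d e. y $ i = B $$ (i, i) * d * v $ i
          + (if 0 < i then B $$ (i, i - 1) * e * v $ (i - 1) else 0)"] by metis
    obtain r c :: "nat \<Rightarrow> real" where cr: "\<And>i. 0 < r i" "\<And>i. 0 < c i"
      "\<And>i. r i * c i = d i" "\<And>i. c i * r (i + 1) = e (i + 1)"
      "\<And>i j n. i < n \<Longrightarrow> j < n \<Longrightarrow> rel_factor (gamma2 u) (2 * n - 1) (1 / (r i * c j))"
      using band_scaling[of d "gamma2 u" "\<lambda>i. e (i + 1)"] de(1,2) g u(3) by metis
    have e: "e i = c (i - 1) * r i" if "0 < i" for i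
      using cr(4)[of "i - 1"] that by simp
    have "y $ i = (\<Sum>j<n. r i * B $$ (i, j) * c j * v $ j)" if i: "i < n" for i
      unfolding de(3)[OF i] cr(3)[symmetric] using i
      by (subst sum_lower_band[of i]) (auto simp: zero e)
    moreover have "\<bar>r i * c j - 1\<bar> \<le> gamma2 u" if "i < n" "j < n" "B $$ (i, j) \<noteq> 0" for i j
    proof -
      have "j = i \<or> i = j + 1" using zero that by blast
      then show ?thesis using de(1)[rule_format, of i] de(2)[rule_format, of i] cr(3)[of i] cr(4)[of j]
        by (auto simp: mult.commute)
    qed
    ultimately show ?thesis
      using cr(1,2,5) by (intro exI[of _ r] exI[of _ c]) auto
  qed
qed

text \<open>
  Reading \<open>y = D\<^sub>r B D\<^sub>c v\<close> in both directions gives a forward perturbation of \<open>B\<close> and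
  a perturbation of its inverse that recovers \<open>v\<close> from \<open>y\<close>.
\<close>

lemma computed_mult_vec_perturbed:
  assumes B: "B \<in> carrier_mat n n" "invertible_mat B" and v: "v \<in> carrier_vec n"
    and model: "standard_model u F fl"
    and n: "n \<ge> 1" and u: "0 \<le> u" "2 * u < 1" "(2 * real n - 1) * gamma2 u < 1"
    and BF: "\<forall>i<n. \<forall>j<n. B $$ (i, j) \<in> F" and vF: "\<forall>i<n. v $ i \<in> F"
    and y: "computed_mult_vec fl B v y"
  shows "y \<in> carrier_vec n" "\<forall>i<n. y $ i \<in> F"
    "\<exists>D. perturbed n (gamma2 u) B D \<and> y = D *\<^sub>v v"
    "\<exists>D. perturbed n (tau n u) (mat_inv B) D \<and> v = D *\<^sub>v y"
proof -
  have g: "0 \<le> gamma2 u" using gamma2_bounds(1)[OF u(1,2), of 0 0] u(1) by simp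
  have "1 * gamma2 u \<le> (2 * real n - 1) * gamma2 u" using n g by (intro mult_right_mono) auto
  then have g1: "gamma2 u < 1" using u(3) by simp
  note sc = computed_mult_vec_scaling[OF B(1) v model u(1,2) g1 BF vF y]
  note inv = mat_inv_works[OF B]
  show yc: "y \<in> carrier_vec n" and "\<forall>i<n. y $ i \<in> F" using sc(1,2) by auto
  obtain r c where "\<forall>i. 0 < r i \<and> 0 < c i"
    and "\<forall>i<n. y $ i = (\<Sum>j<n. r i * B $$ (i, j) * c j * v $ j)"
    and "\<forall>i<n. \<forall>j<n. B $$ (i, j) \<noteq> 0 \<longrightarrow> \<bar>r i * c j - 1\<bar> \<le> gamma2 u"
    and "\<forall>i<n. \<forall>j<n. rel_factor (gamma2 u) (2 * n - 1) (1 / (r i * c j))"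
    using sc(3) by (elim exE conjE) (rule that)
  then have pos: "\<And>i. 0 < r i" "\<And>i. 0 < c i"
    and yi: "\<And>i. i < n \<Longrightarrow> y $ i = (\<Sum>j<n. r i * B $$ (i, j) * c j * v $ j)"
    and rc: "\<And>i j. i < n \<Longrightarrow> j < n \<Longrightarrow> B $$ (i, j) \<noteq> 0 \<Longrightarrow> \<bar>r i * c j - 1\<bar> \<le> gamma2 u"
    and rf: "\<And>i j. i < n \<Longrightarrow> j < n \<Longrightarrow> rel_factor (gamma2 u) (2 * n - 1) (1 / (r i * c j))"
    by blast+
  show "\<exists>D. perturbed n (gamma2 u) B D \<and> y = D *\<^sub>v v"
  proof (intro exI conjI)
    let ?D = "mat n n (\<lambda>(i, j). r i * B $$ (i, j) * c j)"
    have "\<bar>r i * B $$ (i, j) * c j - B $$ (i, j)\<bar> \<le> gamma2 u * \<bar>B $$ (i, j)\<bar>"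
      if ij: "i < n" "j < n" for i j
    proof (cases "B $$ (i, j) = 0")
      case False
      have "r i * B $$ (i, j) * c j - B $$ (i, j) = (r i * c j - 1) * B $$ (i, j)"
        by (simp add: algebra_simps)
      then show ?thesis using rc[OF ij False] by (simp add: abs_mult mult_right_mono)
    qed simp
    then show "perturbed n (gamma2 u) B ?D" using B(1) by (auto simp: perturbed_def)
    show "y = ?D *\<^sub>v v"
      using v yc yi mult_mat_vec_entry[of ?D n v]
      by (intro eq_vecI) (auto simp del: index_mult_mat_vec)
  qed
  show "\<exists>D. perturbed n (tau n u) (mat_inv B) D \<and> v = D *\<^sub>v y"
  proof (intro exI conjI)
    let ?D = "mat n n (\<lambda>(i, j). mat_inv B $$ (i, j) * (1 / (r j * c i)))"
    have "\<bar>mat_inv B $$ (i, j) * (1 / (r j * c i)) - mat_inv B $$ (i, j)\<bar>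
        \<le> tau n u * \<bar>mat_inv B $$ (i, j)\<bar>" if ij: "i < n" "j < n" for i j
    proof -
      have m: "real (2 * n - 1) = 2 * real n - 1" using n by (simp add: of_nat_diff)
      have "\<bar>1 / (r j * c i) - 1\<bar> \<le> tau n u"
        using rel_factor_dist_one[OF rf[OF ij(2,1)] g g1] u(3) unfolding m tau_def by simp
      moreover have "mat_inv B $$ (i, j) * (1 / (r j * c i)) - mat_inv B $$ (i, j)
          = (1 / (r j * c i) - 1) * mat_inv B $$ (i, j)" by (simp add: algebra_simps)
      ultimately show ?thesis by (simp only: abs_mult mult_right_mono abs_ge_zero)
    qed
    then show "perturbed n (tau n u) (mat_inv B) ?D" using inv(3) by (auto simp: perturbed_def)
    \<comment> \<open>Undoing the scalings turns the computed product into the exact one \<open>z = B w\<close>.\<close>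
    define w where "w = vec n (\<lambda>j. c j * v $ j)"
    define z where "z = vec n (\<lambda>i. y $ i / r i)"
    have wz: "w \<in> carrier_vec n" "z \<in> carrier_vec n" by (auto simp: w_def z_def)
    have "z $ i = (\<Sum>j<n. B $$ (i, j) * w $ j)" if "i < n" for i
      using that pos(1)[of i] yi[OF that]
      by (auto simp: z_def w_def sum_divide_distrib intro!: sum.cong)
    then have "z = B *\<^sub>v w"
      using wz B(1) mult_mat_vec_entry[OF B(1) wz(1)]
      by (intro eq_vecI) (auto simp del: index_mult_mat_vec)
    then have wi: "w = mat_inv B *\<^sub>v z"
      using inv(2,3) B(1) wz by (simp flip: assoc_mult_mat_vec[of _ n n _ n])
    have "v $ i = (?D *\<^sub>v y) $ i" if i: "i < n" for i
    proof -
      have "v $ i = w $ i / c i" using i pos(2)[of i] by (simp add: w_def)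
      also have "\<dots> = (\<Sum>j<n. mat_inv B $$ (i, j) * z $ j) / c i"
        using mult_mat_vec_entry[OF inv(3) wz(2) i] wi by simp
      also have "\<dots> = (\<Sum>j<n. mat_inv B $$ (i, j) * (1 / (r j * c i)) * y $ j)"
        by (auto simp: z_def sum_divide_distrib intro!: sum.cong)
      also have "\<dots> = (?D *\<^sub>v y) $ i"
        using i yc by (subst mult_mat_vec_entry[of _ n]) auto
      finally show ?thesis .
    qed
    then show "v = ?D *\<^sub>v y" using v by (intro eq_vecI) (auto simp del: index_mult_mat_vec)
  qed
qed

lemma computed_prod_perturbed:
  assumes Bs: "\<forall>B\<in>set Bs. B \<in> carrier_mat n n \<and> invertible_mat B"
    and b: "b \<in> carrier_vec n"
    and model: "standard_model u F fl"
    and n: "n \<ge> 1" and u: "0 \<le> u" "2 * u < 1" "(2 * real n - 1) * gamma2 u < 1"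
    and BF: "\<forall>B\<in>set Bs. \<forall>i<n. \<forall>j<n. B $$ (i, j) \<in> F" and bF: "\<forall>i<n. b $ i \<in> F"
    and y: "computed_prod fl Bs b y"
  shows "y \<in> carrier_vec n \<and> (\<forall>i<n. y $ i \<in> F) \<and>
    (\<exists>Ds. list_all2 (perturbed n (gamma2 u)) Bs Ds \<and> y = mat_prod n Ds *\<^sub>v b) \<and>
    (\<exists>Ds. list_all2 (perturbed n (tau n u)) (map mat_inv (rev Bs)) Ds \<and> b = mat_prod n Ds *\<^sub>v y)"
  using Bs BF y
proof (induction Bs arbitrary: y)
  case Nil
  then show ?case using b bF by auto
next
  case (Cons B Bs)
  obtain v where v: "computed_prod fl Bs b v" "computed_mult_vec fl B v y"
    using Cons.prems(3) by auto
  have IH: "v \<in> carrier_vec n \<and> (\<forall>i<n. v $ i \<in> F) \<and>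
    (\<exists>Ds. list_all2 (perturbed n (gamma2 u)) Bs Ds \<and> v = mat_prod n Ds *\<^sub>v b) \<and>
    (\<exists>Ds. list_all2 (perturbed n (tau n u)) (map mat_inv (rev Bs)) Ds \<and> b = mat_prod n Ds *\<^sub>v v)"
    using Cons.prems v(1) by (intro Cons.IH) auto
  then obtain Ds Es where vc: "v \<in> carrier_vec n" "\<forall>i<n. v $ i \<in> F"
    and Ds: "list_all2 (perturbed n (gamma2 u)) Bs Ds" "v = mat_prod n Ds *\<^sub>v b"
    and Es: "list_all2 (perturbed n (tau n u)) (map mat_inv (rev Bs)) Es" "b = mat_prod n Es *\<^sub>v v"
    by blast
  have B: "B \<in> carrier_mat n n" "invertible_mat B" using Cons.prems(1) by auto
  have BF': "\<forall>i<n. \<forall>j<n. B $$ (i, j) \<in> F" using Cons.prems(2) by auto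
  note step = computed_mult_vec_perturbed[OF B vc(1) model n u BF' vc(2) v(2)]
  obtain D where D: "perturbed n (gamma2 u) B D" "y = D *\<^sub>v v" using step(3) by blast
  obtain E where E: "perturbed n (tau n u) (mat_inv B) E" "v = E *\<^sub>v y" using step(4) by blast
  have mem: "set Ds \<subseteq> carrier_mat n n" "set Es \<subseteq> carrier_mat n n"
    using Ds(1) Es(1) by (auto simp: list_all2_conv_all_nth in_set_conv_nth perturbed_def)
  have carr: "D \<in> carrier_mat n n" "E \<in> carrier_mat n n"
    "mat_prod n Ds \<in> carrier_mat n n" "mat_prod n Es \<in> carrier_mat n n"
    using D(1) E(1) mem by (auto simp: perturbed_def intro: mat_prod_carrier)
  have "y = mat_prod n (D # Ds) *\<^sub>v b"
    using carr b D(2) Ds(2) by (simp add: assoc_mult_mat_vec[of _ n n _ n])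
  moreover have "b = mat_prod n (Es @ [E]) *\<^sub>v y"
    unfolding mat_prod_snoc[OF mem(2) carr(2)]
    using assoc_mult_mat_vec[OF carr(4,2) step(1)] Es(2) E(2) by simp
  moreover have "list_all2 (perturbed n (gamma2 u)) (B # Bs) (D # Ds)" using D Ds by simp
  moreover have "list_all2 (perturbed n (tau n u)) (map mat_inv (rev (B # Bs))) (Es @ [E])"
    using E(1) Es(1) by (simp add: list_all2_appendI)
  ultimately show ?case using step(1,2) by blast
qed

section \<open>The first-order term of the residual bound\<close>

text \<open>
  With \<open>m = 2n - 1\<close>, \<open>tau n v = 2mv / (1 - 2v - 2mv)\<close> near \<open>0\<close>, so the difference is
  \<open>v\<^sup>2\<close> times a function with a limit.
\<close>

lemma tau_first_order:
  "(\<lambda>v. tau n v - 2 * (2 * real n - 1) * v) \<in> O[at_right 0](\<lambda>v. v ^ 2)"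
proof -
  define m where "m = 2 * real n - 1"
  have "((\<lambda>v. 1 / (1 - 2 * v - 2 * m * v)) \<longlongrightarrow> 1 / (1 - 2 * 0 - 2 * m * 0)) (at_right 0)"
    by (intro tendsto_intros) auto
  then have "(\<lambda>v. 1 / (1 - 2 * v - 2 * m * v)) \<in> O[at_right 0](\<lambda>_. 1)"
    by (intro bigoI_tendsto[where c = 1]) auto
  then have "(\<lambda>v. (4 * m * (1 + m) * v ^ 2) * (1 / (1 - 2 * v - 2 * m * v)))
      \<in> O[at_right 0](\<lambda>v. v ^ 2 * 1)"
    by (intro landau_o.big.mult) auto
  moreover have "((\<lambda>v. 1 - 2 * v) \<longlongrightarrow> 1 - 2 * 0) (at_right (0::real))"
    "((\<lambda>v. 1 - 2 * v - 2 * m * v) \<longlongrightarrow> 1 - 2 * 0 - 2 * m * 0) (at_right 0)"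
    by (intro tendsto_intros)+
  then have "\<forall>\<^sub>F v in at_right (0::real). 1 - 2 * v > 0" "\<forall>\<^sub>F v in at_right 0. 1 - 2 * v - 2 * m * v > 0"
    by (auto dest: order_tendstoD(1)[where a = 0])
  then have "\<forall>\<^sub>F v in at_right 0. tau n v - 2 * m * v
      = (4 * m * (1 + m) * v ^ 2) * (1 / (1 - 2 * v - 2 * m * v))"
  proof eventually_elim
    case (elim v)
    have "m * gamma2 v = 2 * m * v / (1 - 2 * v)" by (simp add: gamma2_def)
    moreover have "1 - 2 * m * v / (1 - 2 * v) = (1 - 2 * v - 2 * m * v) / (1 - 2 * v)"
      using elim by (simp add: field_simps)
    ultimately have "tau n v = 2 * m * v / (1 - 2 * v - 2 * m * v)"
      using elim by (simp add: tau_def flip: m_def)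
    then show ?case
      using elim by (simp add: divide_simps) (simp add: algebra_simps power2_eq_square)
  qed
  ultimately show ?thesis
    by (subst landau_o.big.in_cong) (auto simp: m_def)
qed

text \<open>
  Induction on \<open>k\<close>: the error for \<open>k + 1\<close> is the error for \<open>k\<close> times \<open>1 + t v\<close>, plus
  \<open>k * a * v * t v\<close> and \<open>t v - a * v\<close>, all of second order.
\<close>

lemma power_one_plus_first_order:
  fixes t :: "real \<Rightarrow> real"
  assumes t: "(\<lambda>v. t v - a * v) \<in> O[at_right 0](\<lambda>v. v ^ 2)"
  shows "(\<lambda>v. (1 + t v) ^ k - 1 - real k * a * v) \<in> O[at_right 0](\<lambda>v. v ^ 2)"
proof (induction k)
  case 0
  then show ?case by simp
next
  case (Suc k)
  have sq: "(\<lambda>v::real. v ^ 2) \<in> O[at_right 0](\<lambda>v. v)" by real_asymp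
  have lin: "(\<lambda>v. a * v) \<in> O[at_right 0](\<lambda>v::real. v)" by simp
  have "(\<lambda>v. (t v - a * v) + a * v) \<in> O[at_right 0](\<lambda>v. v)"
    using t sq lin by (intro sum_in_bigo(1)) (auto intro: landau_o.big_trans)
  then have tO: "t \<in> O[at_right 0](\<lambda>v. v)" by simp
  have v1: "(\<lambda>v::real. v) \<in> O[at_right 0](\<lambda>v. 1)" by real_asymp
  have one: "(\<lambda>v. 1 + t v) \<in> O[at_right 0](\<lambda>v. 1)"
    using tO v1 by (intro sum_in_bigo(1)) (auto intro: landau_o.big_trans)
  have A: "(\<lambda>v. ((1 + t v) ^ k - 1 - real k * a * v) * (1 + t v)) \<in> O[at_right 0](\<lambda>v. v ^ 2 * 1)"
    using Suc one by (rule landau_o.big.mult)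
  have B: "(\<lambda>v. (real k * a * v) * t v) \<in> O[at_right 0](\<lambda>v. v * v)"
    using tO by (intro landau_o.big.mult) auto
  have "(\<lambda>v. ((1 + t v) ^ k - 1 - real k * a * v) * (1 + t v) + (real k * a * v) * t v + (t v - a * v))
      \<in> O[at_right 0](\<lambda>v. v ^ 2)"
    using A B t by (intro sum_in_bigo(1)) (auto simp: power2_eq_square)
  moreover have "(1 + t v) ^ Suc k - 1 - real (Suc k) * a * v
      = ((1 + t v) ^ k - 1 - real k * a * v) * (1 + t v) + (real k * a * v) * t v + (t v - a * v)" for v
    by (simp add: algebra_simps)
  ultimately show ?case by simp
qed

section \<open>Forward error and residual\<close>

theorem mainTheorem4:
  fixes n k :: nat and A :: "real mat" and Bs :: "real mat list" and b x xhat :: "real vec"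
    and u :: real and F :: "real set" and fl :: "fp_op \<Rightarrow> real \<Rightarrow> real \<Rightarrow> real"
  assumes n: "n \<ge> 1"
    and A: "A \<in> carrier_mat n n" "invertible_mat A"
    and k: "length Bs = k"
    and Bs: "\<And>B. B \<in> set Bs \<Longrightarrow> B \<in> carrier_mat n n \<and> invertible_mat B \<and>
                                  (upper_bidiagonal B \<or> lower_bidiagonal B)"
    and A_inv: "mat_inv A = mat_prod n Bs"
    and b: "b \<in> carrier_vec n"
    and x: "x = mat_inv A *\<^sub>v b"
    and model: "standard_model u F fl"
    and b_fp: "\<And>i. i < n \<Longrightarrow> b $ i \<in> F"
    and Bs_fp: "\<And>B i j. B \<in> set Bs \<Longrightarrow> i < n \<Longrightarrow> j < n \<Longrightarrow> B $$ (i, j) \<in> F"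
    and xhat: "computed_prod fl Bs b xhat"
    and u: "0 \<le> u" "2 * u < 1" "(2 * real n - 1) * gamma2 u < 1"
  shows
    "vec_abs (xhat - x)
       \<le> ((1 + gamma2 u) ^ k - 1) \<cdot>\<^sub>v (mat_prod n (map mat_abs Bs) *\<^sub>v vec_abs b) \<and>
     vec_abs (b - A *\<^sub>v xhat)
       \<le> ((1 + tau n u) ^ k - 1) \<cdot>\<^sub>v
           (mat_prod n (map (\<lambda>B. mat_abs (mat_inv B)) (rev Bs)) *\<^sub>v vec_abs xhat) \<and>
     ((\<forall>B\<in>set Bs. nonneg_mat B) \<or> (\<forall>B\<in>set Bs. checkerboard B) \<longrightarrow>
        vec_abs (xhat - x)
          \<le> ((1 + gamma2 u) ^ k - 1) \<cdot>\<^sub>v (mat_abs (mat_inv A) *\<^sub>v vec_abs b) \<and>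
        vec_abs (b - A *\<^sub>v xhat)
          \<le> ((1 + tau n u) ^ k - 1) \<cdot>\<^sub>v (mat_abs A *\<^sub>v vec_abs xhat) \<and>
        (\<exists>R. R \<in> O[at_right 0](\<lambda>v. v ^ 2) \<and>
             (\<forall>v. (1 + tau n v) ^ k - 1 = 2 * real k * (2 * real n - 1) * v + R v) \<and>
             ((1 + tau n u) ^ k - 1) \<cdot>\<^sub>v (mat_abs A *\<^sub>v vec_abs xhat)
               = (2 * real k * (2 * real n - 1) * u + R u) \<cdot>\<^sub>v (mat_abs A *\<^sub>v vec_abs xhat)))"
proof -
  have Bs': "\<forall>B\<in>set Bs. B \<in> carrier_mat n n \<and> invertible_mat B" using Bs by blast
  have Bs_fp': "\<forall>B\<in>set Bs. \<forall>i<n. \<forall>j<n. B $$ (i, j) \<in> F" and b_fp': "\<forall>i<n. b $ i \<in> F"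
    using Bs_fp b_fp by blast+
  have g: "0 \<le> gamma2 u" using gamma2_bounds(1)[OF u(1,2), of 0 0] u(1) by simp
  have t: "0 \<le> tau n u" using g u(3) n unfolding tau_def by simp
  note invA = mat_inv_works[OF A]
  obtain Ds Es where xc: "xhat \<in> carrier_vec n"
    and Ds: "list_all2 (perturbed n (gamma2 u)) Bs Ds" "xhat = mat_prod n Ds *\<^sub>v b"
    and Es: "list_all2 (perturbed n (tau n u)) (map mat_inv (rev Bs)) Es"
      "b = mat_prod n Es *\<^sub>v xhat"
    using computed_prod_perturbed[OF Bs' b model n u Bs_fp' b_fp' xhat] by blast
  have inv_carrier: "set (map mat_inv (rev Bs)) \<subseteq> carrier_mat n n"
    using Bs' by (auto intro!: mat_inv_works(3))
  let ?Q = "mat_prod n (map mat_inv (rev Bs))"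
  have Q: "?Q \<in> carrier_mat n n" using inv_carrier by (rule mat_prod_carrier)
  have "A = (?Q * mat_inv A) * A"
    using mat_prod_inv_rev[OF Bs'] A(1) A_inv by simp
  also have "\<dots> = ?Q * (mat_inv A * A)" using Q invA(3) A(1) by (rule assoc_mult_mat)
  also have "\<dots> = ?Q" using Q invA(2) by simp
  finally have AQ: "A = ?Q" .
  have fwd: "vec_abs (xhat - x)
      \<le> ((1 + gamma2 u) ^ k - 1) \<cdot>\<^sub>v (mat_prod n (map mat_abs Bs) *\<^sub>v vec_abs b)"
    using mat_prod_perturbed_mult_vec[OF Ds(1) g b] by (simp add: x A_inv k flip: Ds(2))
  have bwd: "vec_abs (b - A *\<^sub>v xhat)
      \<le> ((1 + tau n u) ^ k - 1) \<cdot>\<^sub>v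
         (mat_prod n (map (\<lambda>B. mat_abs (mat_inv B)) (rev Bs)) *\<^sub>v vec_abs xhat)"
    using mat_prod_perturbed_mult_vec[OF Es(1) t xc]
    by (simp add: k comp_def flip: Es(2) AQ)
  have structured: "mat_prod n (map mat_abs Bs) = mat_abs (mat_inv A)"
    "mat_prod n (map (\<lambda>B. mat_abs (mat_inv B)) (rev Bs)) = mat_abs A"
    if "(\<forall>B\<in>set Bs. nonneg_mat B) \<or> (\<forall>B\<in>set Bs. checkerboard B)"
  proof -
    obtain \<sigma> :: "nat \<Rightarrow> real" where \<sigma>: "\<forall>i. \<bar>\<sigma> i\<bar> = 1"
      and pat: "\<And>B. B \<in> set Bs \<Longrightarrow> sign_pattern n \<sigma> B"
    proof (cases "\<forall>B\<in>set Bs. nonneg_mat B")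
      case True
      then show ?thesis using that[of "\<lambda>_. 1"] nonneg_mat_sign_pattern Bs' by auto
    next
      case False
      then have "\<forall>B\<in>set Bs. checkerboard B"
        using \<open>(\<forall>B\<in>set Bs. nonneg_mat B) \<or> (\<forall>B\<in>set Bs. checkerboard B)\<close> by blast
      then show ?thesis
        using that[of "\<lambda>i. (-1) ^ i"] checkerboard_sign_pattern Bs' by auto
    qed
    show "mat_prod n (map mat_abs Bs) = mat_abs (mat_inv A)"
      unfolding A_inv using mat_abs_mat_prod[of \<sigma> Bs n] \<sigma> pat Bs' by simp
    have "mat_abs ?Q = mat_prod n (map mat_abs (map mat_inv (rev Bs)))"
    proof (rule mat_abs_mat_prod; intro allI ballI)
      show "\<bar>(-1) ^ i * \<sigma> i\<bar> = 1" for i using \<sigma> by (simp add: abs_mult)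
      fix C assume "C \<in> set (map mat_inv (rev Bs))"
      then obtain B where B: "B \<in> set Bs" "C = mat_inv B" by auto
      then show "C \<in> carrier_mat n n \<and> sign_pattern n (\<lambda>i. (-1) ^ i * \<sigma> i) C"
        using bidiagonal_inverse_sign_pattern[OF \<sigma>, of B n C] mat_inv_works[of B n] Bs pat by blast
    qed
    then show "mat_prod n (map (\<lambda>B. mat_abs (mat_inv B)) (rev Bs)) = mat_abs A"
      by (simp add: comp_def flip: AQ)
  qed
  define R where "R v = (1 + tau n v) ^ k - 1 - 2 * real k * (2 * real n - 1) * v" for v
  have "R \<in> O[at_right 0](\<lambda>v. v ^ 2)"
    using power_one_plus_first_order[OF tau_first_order, of n k]
    unfolding R_def by (simp add: mult.assoc mult.left_commute)
  then have order: "\<exists>R. R \<in> O[at_right 0](\<lambda>v. v ^ 2) \<and>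
      (\<forall>v. (1 + tau n v) ^ k - 1 = 2 * real k * (2 * real n - 1) * v + R v) \<and>
      ((1 + tau n u) ^ k - 1) \<cdot>\<^sub>v (mat_abs A *\<^sub>v vec_abs xhat)
        = (2 * real k * (2 * real n - 1) * u + R u) \<cdot>\<^sub>v (mat_abs A *\<^sub>v vec_abs xhat)"
    by (intro exI[of _ R]) (simp add: R_def)
  show ?thesis
    using fwd bwd structured order by metis
qed

end
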